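(* There is $\lambda_0>0$ such that for every $\lambda\in(0,\lambda_0)$ the following holds. For $\boldsymbol l\in\mathbb Z^2$ define the admissible wavenumbers and observation directions $$k_{\boldsymbol l}=\begin{cases}\dfrac{2\pi}{a}|\boldsymbol l|,&\boldsymbol l\neq\boldsymbol 0,\\[2mm] \dfrac{2\pi}{a}\lambda,&\boldsymbol l=\boldsymbol 0,\end{cases}\qquad \widehat x_{\boldsymbol l}=\begin{cases}\dfrac{\boldsymbol l}{|\boldsymbol l|},&\boldsymbol l\neq\boldsymbol 0,\\[2mm] (1,0),&\boldsymbol l=\boldsymbol 0.\end{cases}$$ Then the Fourier coefficients $\{\widehat g_{\boldsymbol l}\}_{\boldsymbol l\in\mathbb Z^2}$ of the mean $g$ of the random source $f=g+\sigma\dot W_x$ are determined by the data $\{\mathbf E[u^\infty(\widehat x_{\boldsymbol l};k_{\boldsymbol l})]\}_{\boldsymbol l\in\mathbb Z^2}$; that is, if two admissible sources, given by $(g,\sigma)$ and $(g',\sigma')$, with far-field patterns $u^\infty$ and $u'^\infty$, satisfy $\mathbf E[u^\infty(\widehat x_{\boldsymbol l};k_{\boldsymbol l})]=\mathbf E[u'^\infty(\widehat x_{\boldsymbol l};k_{\boldsymbol l})]$ for all $\boldsymbol l\in\mathbb Z^2$, then $\widehat g_{\boldsymbol l}=\widehat{g'}_{\boldsymbol l}$ for all $\boldsymbol l\in\mathbb Z^2$.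
   Context: Let $a>0$, $\Omega=(-a/2,a/2)\times(-a/2,a/2)\subset\mathbb R^2$ and $\mathbb S=\{x\in\mathbb R^2:|x|=1\}$. An admissible source is a random function $f=g+\sigma\dot W_x$, where $g$ and $\sigma\ge 0$ are deterministic real functions, independent of the wavenumber, compactly supported in $\Omega$, with $g,\sigma^2\in L^2(\Omega)$, and $\dot W_x$ is homogeneous white noise, the derivative of a one-dimensional two-parameter Brownian sheet $W(x)$. Integrals $\int_\Omega\psi(y)\,\mathrm dW_y$ of deterministic (possibly complex-valued) $\psi\in L^2(\Omega)$ are Wiener integrals against this white noise. $\mathbf E$ denotes expectation. For wavenumber $k>0$, the radiating field $u$ solves $\Delta u+k^2u=-f$ in $\mathbb R^2$ with the Sommerfeld radiation condition $\lim_{r=|x|\to\infty}\sqrt r(\partial_ru-\mathrm iku)=0$ (in the mild sense), and its far-field pattern in direction $\widehat x\in\mathbb S$ is $$u^\infty(\widehat x;k)=\int_\Omega G_k^\infty(\widehat x,y)g(y)\,\mathrm dy+\int_\Omega G_k^\infty(\widehat x,y)\sigma(y)\,\mathrm dW_y,\qquad G_k^\infty(\widehat x,y)=\frac{\mathrm e^{\mathrm i\pi/4}}{\sqrt{8\pi k}}\mathrm e^{-\mathrm ik\widehat x\cdot y}.$$ The Fourier basis is $\phi_{\boldsymbol l}(x)=\mathrm e^{\mathrm i\frac{2\pi}{a}\boldsymbol l\cdot x}$, $\boldsymbol l\in\mathbb Z^2$, and the Fourier coefficients of $g$ are $\widehat g_{\boldsymbol l}=\frac1{a^2}\int_\Omega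 g(x)\overline{\phi_{\boldsymbol l}(x)}\,\mathrm dx$, so that $g=\sum_{\boldsymbol l\in\mathbb Z^2}\widehat g_{\boldsymbol l}\phi_{\boldsymbol l}$ in $L^2(\Omega)$. $|\boldsymbol l|$ is the Euclidean norm. *)

theory Defs
  imports "HOL-Probability.Probability"
begin

definition square :: "real \<Rightarrow> (real \<times> real) set" where
  "square a = {-a/2<..<a/2} \<times> {-a/2<..<a/2}"

definition L2_on ::
    "(real \<times> real) set \<Rightarrow> (real \<times> real \<Rightarrow> 'b::{banach, second_countable_topology}) \<Rightarrow> bool" where
  "L2_on S f \<longleftrightarrow> set_borel_measurable lebesgue S f \<and>
     set_integrable lebesgue S (\<lambda>x. (norm (f x))\<^sup>2)"

text \<open>The support is taken in the almost-everywhere sense, as is appropriate for elements of L2.\<close>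

definition compactly_supported_in ::
    "(real \<times> real) set \<Rightarrow> (real \<times> real \<Rightarrow> real) \<Rightarrow> bool" where
  "compactly_supported_in S f \<longleftrightarrow>
     (\<exists>K. compact K \<and> K \<subseteq> S \<and> (AE x in lebesgue. x \<notin> K \<longrightarrow> f x = 0))"

text \<open>The degenerate Gaussian (a point mass at 0) is admitted, since linear combinations of the
  values of a Gaussian process may vanish identically.\<close>

definition centered_gaussian :: "'w measure \<Rightarrow> ('w \<Rightarrow> real) \<Rightarrow> bool" where
  "centered_gaussian M X \<longleftrightarrow> X \<in> borel_measurable M \<and>
     ((AE w in M. X w = 0) \<or> (\<exists>s>0. distributed M lborel X (normal_density 0 s)))"

text \<open>The Brownian sheet is indexed by the whole plane (not only by the first quadrant), because
  the square contains points of every quadrant. The factor \<open>(\<bar>s\<bar> + \<bar>t\<bar> - \<bar>s - t\<bar>) / 2\<close> equals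
  \<open>min \<bar>s\<bar> \<bar>t\<bar>\<close> if \<open>s\<close> and \<open>t\<close> have the same sign, and 0 otherwise. Hence the
  increments over two rectangles have as covariance the area of the intersection, which is what
  characterises homogeneous white noise.\<close>

definition brownian_sheet :: "'w measure \<Rightarrow> (real \<times> real \<Rightarrow> 'w \<Rightarrow> real) \<Rightarrow> bool" where
  "brownian_sheet M W \<longleftrightarrow> prob_space M \<and>
     (\<forall>T c. finite T \<longrightarrow> centered_gaussian M (\<lambda>w. \<Sum>x\<in>T. c x * W x w)) \<and>
     (\<forall>x y. prob_space.expectation M (\<lambda>w. W x w * W y w) =
        (\<bar>fst x\<bar> + \<bar>fst y\<bar> - \<bar>fst x - fst y\<bar>) / 2 * ((\<bar>snd x\<bar> + \<bar>snd y\<bar> - \<bar>snd x - snd y\<bar>) / 2))"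

text \<open>A list entry \<open>(c, p, q)\<close> stands for the constant \<open>c\<close> on the half-open rectangle with lower
  left corner \<open>p\<close> and upper right corner \<open>q\<close>; overlapping rectangles add up.\<close>

type_synonym step = "(complex \<times> (real \<times> real) \<times> (real \<times> real)) list"

definition valid_step :: "step \<Rightarrow> bool" where
  "valid_step s \<longleftrightarrow> (\<forall>(c, p, q)\<in>set s. fst p \<le> fst q \<and> snd p \<le> snd q)"

definition step_fun :: "step \<Rightarrow> real \<times> real \<Rightarrow> complex" where
  "step_fun s x =
     (\<Sum>(c, p, q)\<leftarrow>s. c * indicator ({fst p<..fst q} \<times> {snd p<..snd q}) x)"

definition increment ::
    "(real \<times> real \<Rightarrow> 'w \<Rightarrow> real) \<Rightarrow> real \<times> real \<Rightarrow> real \<times> real \<Rightarrow> 'w \<Rightarrow> real" where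
  "increment W p q w = W (fst q, snd q) w - W (fst p, snd q) w - W (fst q, snd p) w + W (fst p, snd p) w"

definition step_integral :: "(real \<times> real \<Rightarrow> 'w \<Rightarrow> real) \<Rightarrow> step \<Rightarrow> 'w \<Rightarrow> complex" where
  "step_integral W s w = (\<Sum>(c, p, q)\<leftarrow>s. c * of_real (increment W p q w))"

text \<open>The Wiener integral is the isometric extension of the elementary integral to L2. It is an
  element of L2 of the probability space, that is, it is determined only up to null sets, so it is
  given as a relation: \<open>X\<close> is a version of the integral of \<open>\<psi>\<close> over \<open>S\<close>. The two limits are
  convergence in L2 of the plane and in L2 of the probability space, written with the nonnegative
  integral, which does not default to 0 for functions that are not integrable.\<close>

definition has_wiener_integral ::
    "'w measure \<Rightarrow> (real \<times> real \<Rightarrow> 'w \<Rightarrow> real) \<Rightarrow> (real \<times> real) set \<Rightarrow>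
     (real \<times> real \<Rightarrow> complex) \<Rightarrow> ('w \<Rightarrow> complex) \<Rightarrow> bool" where
  "has_wiener_integral M W S \<psi> X \<longleftrightarrow>
     L2_on S \<psi> \<and> X \<in> borel_measurable M \<and>
     (\<exists>s :: nat \<Rightarrow> step.
        (\<forall>n. valid_step (s n)) \<and>
        (\<lambda>n. \<integral>\<^sup>+x. ennreal ((cmod (indicator S x * \<psi> x - step_fun (s n) x))\<^sup>2) \<partial>lebesgue)
          \<longlonglongrightarrow> 0 \<and>
        (\<lambda>n. \<integral>\<^sup>+w. ennreal ((cmod (X w - step_integral W (s n) w))\<^sup>2) \<partial>M) \<longlonglongrightarrow> 0)"

definition admissible_source ::
    "real \<Rightarrow> (real \<times> real \<Rightarrow> real) \<Rightarrow> (real \<times> real \<Rightarrow> real) \<Rightarrow> bool" where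
  "admissible_source a g \<sigma> \<longleftrightarrow>
     compactly_supported_in (square a) g \<and> compactly_supported_in (square a) \<sigma> \<and>
     (AE x in lebesgue. 0 \<le> \<sigma> x) \<and>
     L2_on (square a) g \<and> L2_on (square a) (\<lambda>x. (\<sigma> x)\<^sup>2)"

definition far_field_kernel :: "real \<Rightarrow> real \<times> real \<Rightarrow> real \<times> real \<Rightarrow> complex" where
  "far_field_kernel k xhat y =
     exp (\<i> * of_real (pi / 4)) / of_real (sqrt (8 * pi * k)) * exp (- \<i> * of_real (k * (xhat \<bullet> y)))"

text \<open>The far-field pattern \<open>u\<close> takes the observation direction and the wavenumber as arguments;
  for each of these it is a random variable, determined up to null sets.\<close>

definition is_far_field ::
    "'w measure \<Rightarrow> (real \<times> real \<Rightarrow> 'w \<Rightarrow> real) \<Rightarrow> real \<Rightarrow> (real \<times> real \<Rightarrow> real) \<Rightarrow>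
     (real \<times> real \<Rightarrow> real) \<Rightarrow> (real \<times> real \<Rightarrow> real \<Rightarrow> 'w \<Rightarrow> complex) \<Rightarrow> bool" where
  "is_far_field M W a g \<sigma> u \<longleftrightarrow>
     (\<forall>xhat\<in>sphere 0 1. \<forall>k>0. \<exists>I.
        has_wiener_integral M W (square a) (\<lambda>y. far_field_kernel k xhat y * of_real (\<sigma> y)) I \<and>
        (\<forall>w\<in>space M.
           u xhat k w = (LINT y:square a|lebesgue. far_field_kernel k xhat y * of_real (g y)) + I w))"

definition lattice_vec :: "int \<times> int \<Rightarrow> real \<times> real" where
  "lattice_vec l = (of_int (fst l), of_int (snd l))"

definition fourier_basis :: "real \<Rightarrow> int \<times> int \<Rightarrow> real \<times> real \<Rightarrow> complex" where
  "fourier_basis a l x = exp (\<i> * of_real (2 * pi / a * (lattice_vec l \<bullet> x)))"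

definition fourier_coeff :: "real \<Rightarrow> (real \<times> real \<Rightarrow> real) \<Rightarrow> int \<times> int \<Rightarrow> complex" where
  "fourier_coeff a g l =
     1 / of_real (a\<^sup>2) * (LINT x:square a|lebesgue. of_real (g x) * cnj (fourier_basis a l x))"

definition wavenumber :: "real \<Rightarrow> real \<Rightarrow> int \<times> int \<Rightarrow> real" where
  "wavenumber a lam l = (if l \<noteq> (0, 0) then 2 * pi / a * norm (lattice_vec l) else 2 * pi / a * lam)"

definition direction :: "int \<times> int \<Rightarrow> real \<times> real" where
  "direction l = (if l \<noteq> (0, 0) then lattice_vec l /\<^sub>R norm (lattice_vec l) else (1, 0))"

end

theory Submission
  imports Defs
begin

text \<open>Wiener integrals have mean zero, so the mean far field in direction \<open>xhat\<close> at wavenumber \<open>k\<close>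
  is a nonzero constant times the Fourier integral of \<open>g\<close> at \<open>k xhat\<close>. For \<open>l \<noteq> 0\<close> this is a multiple
  of the Fourier coefficient itself. For \<open>l = 0\<close> let \<open>h\<close> be the difference of the two means and
  \<open>\<theta> = 2 \<pi> x\<^sub>1 / a\<close>. The coefficients at \<open>(m, 0)\<close> with \<open>m > 0\<close> show that \<open>h\<close> is orthogonal to
  \<open>cos (m \<theta>)\<close>, so by Weierstrass approximation integrating \<open>f (cos \<theta>)\<close> against \<open>h\<close> gives the integral
  of \<open>h\<close> times the mean of \<open>f \<circ> cos\<close> over a period, for every continuous \<open>f\<close>. With
  \<open>f = cos \<circ> (\<lambda> arccos)\<close> the left-hand side vanishes by the data at \<open>l = 0\<close>, while the mean of
  \<open>cos (\<lambda> t)\<close> is \<open>sin (\<lambda> \<pi>) / (\<lambda> \<pi>) > 0\<close> for \<open>\<lambda> < 1\<close>; hence \<open>\<lambda>\<^sub>0 = 1\<close> works.\<close>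

section \<open>Wiener integrals are centred\<close>

lemma centered_gaussian_mean_zero:
  assumes "prob_space M" "centered_gaussian M X"
  shows "has_bochner_integral M X 0"
proof -
  interpret prob_space M by fact
  have [measurable]: "X \<in> borel_measurable M"
    using assms(2) by (simp add: centered_gaussian_def)
  from assms(2) consider "AE w in M. X w = 0"
    | s where "s > 0" "distributed M lborel X (normal_density 0 s)"
    unfolding centered_gaussian_def by auto
  then show ?thesis
  proof cases
    case 1
    then show ?thesis
      using has_bochner_integral_cong_AE[of X M "\<lambda>_. 0" 0] has_bochner_integral_zero[of M]
      by simp
  next
    case 2
    have "integrable lborel (\<lambda>x. normal_density 0 s x * x)"
      using integrable_normal_moment_nz_1[OF 2(1), of 0] .
    then have "integrable M X"
      using distributed_integrable_var[OF 2(2)] 2(1) by simp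
    moreover have "(\<integral>w. X w \<partial>M) = 0"
      using distributed_integral[OF 2(2), of "\<lambda>x. x"] integral_normal_moment_nz_1[OF 2(1), of 0]
        2(1) by simp
    ultimately show ?thesis
      by (simp add: has_bochner_integral_iff)
  qed
qed

lemma brownian_sheet_mean_zero:
  assumes "brownian_sheet M W"
  shows "has_bochner_integral M (W x) 0"
proof -
  \<comment> \<open>The Gaussian condition concerns finite linear combinations; a singleton with
    coefficient 1 gives a single value of the sheet.\<close>
  have "centered_gaussian M (\<lambda>w. \<Sum>y\<in>{x}. 1 * W y w)"
    using assms unfolding brownian_sheet_def by (elim conjE allE) (erule mp, simp)
  then show ?thesis
    using assms centered_gaussian_mean_zero[of M "W x"] by (simp add: brownian_sheet_def)
qed

lemma step_integral_mean_zero: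
  assumes "brownian_sheet M W"
  shows "has_bochner_integral M (step_integral W s) 0"
proof (induction s)
  case Nil
  then show ?case
    using has_bochner_integral_zero[of M] by (simp add: step_integral_def[abs_def])
next
  case (Cons z s)
  obtain c p q where z: "z = (c, p, q)" by (cases z)
  have "has_bochner_integral M (increment W p q) (0 - 0 - 0 + 0)"
    unfolding increment_def[abs_def]
    by (intro has_bochner_integral_add has_bochner_integral_diff brownian_sheet_mean_zero[OF assms])
  then have "has_bochner_integral M (\<lambda>w. c * complex_of_real (increment W p q w)) (c * of_real 0)"
    by (intro has_bochner_integral_mult_right has_bochner_integral_of_real) simp
  from has_bochner_integral_add[OF this Cons.IH] show ?case
    by (simp add: step_integral_def[abs_def] z)
qed

text \<open>This plays the role of Cauchy-Schwarz. Pointwise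
  \<open>z \<le> e + z\<^sup>2 / e\<close> for \<open>z \<ge> 0\<close>, since either
  \<open>z \<le> e\<close> or \<open>z * e \<le> z\<^sup>2\<close>; on total mass 1 each summand
  integrates to at most \<open>e\<close>. Working with nonnegative integrals yields integrability
  together with the bound.\<close>

lemma (in prob_space) integral_norm_le_of_L2:
  fixes Z :: "'a \<Rightarrow> 'b::{banach, second_countable_topology}"
  assumes [measurable]: "Z \<in> borel_measurable M" and "e > 0"
    and le: "(\<integral>\<^sup>+w. ennreal ((norm (Z w))\<^sup>2) \<partial>M) \<le> ennreal (e\<^sup>2)"
  shows "integrable M Z" "norm (\<integral>w. Z w \<partial>M) \<le> 2 * e"
proof -
  have "norm (Z w) \<le> e + (1 / e) * (norm (Z w))\<^sup>2" for w
  proof (cases "norm (Z w) \<le> e")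
    case False
    then have "norm (Z w) * e \<le> norm (Z w) * norm (Z w)"
      by (intro mult_left_mono) auto
    then have "norm (Z w) \<le> (1 / e) * (norm (Z w))\<^sup>2"
      using \<open>e > 0\<close> by (simp add: field_simps power2_eq_square)
    then show ?thesis using \<open>e > 0\<close> by linarith
  qed (use \<open>e > 0\<close> in \<open>simp add: add_increasing2\<close>)
  then have "(\<integral>\<^sup>+w. ennreal (norm (Z w)) \<partial>M)
      \<le> (\<integral>\<^sup>+w. ennreal e + ennreal (1 / e) * ennreal ((norm (Z w))\<^sup>2) \<partial>M)"
    using \<open>e > 0\<close>
    by (intro nn_integral_mono) (simp flip: ennreal_plus ennreal_mult add: ennreal_leI)
  also have "\<dots> = ennreal e + ennreal (1 / e) * (\<integral>\<^sup>+w. ennreal ((norm (Z w))\<^sup>2) \<partial>M)"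
    by (simp add: nn_integral_add nn_integral_cmult emeasure_space_1)
  also have "\<dots> \<le> ennreal e + ennreal (1 / e) * ennreal (e\<^sup>2)"
    using le by (intro add_left_mono mult_left_mono) auto
  also have "\<dots> = ennreal (2 * e)"
    using \<open>e > 0\<close> by (simp flip: ennreal_plus ennreal_mult add: power2_eq_square)
  finally have bound: "(\<integral>\<^sup>+w. ennreal (norm (Z w)) \<partial>M) \<le> ennreal (2 * e)" .
  then show int: "integrable M Z"
    by (intro integrableI_bounded) (auto intro: le_less_trans)
  have "ennreal (\<integral>w. norm (Z w) \<partial>M) \<le> ennreal (2 * e)"
    using bound int by (simp add: nn_integral_eq_integral)
  then have "(\<integral>w. norm (Z w) \<partial>M) \<le> 2 * e"
    using \<open>e > 0\<close> by simp
  then show "norm (\<integral>w. Z w \<partial>M) \<le> 2 * e"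
    using integral_norm_bound[of M Z] by linarith
qed

text \<open>The mean is continuous in L2 of a probability space and vanishes on step integrals.
  \<open>X\<close> is a step integral plus an L2-small remainder, so \<open>X\<close> is integrable
  and its mean equals that of the remainder, which is arbitrarily small.\<close>

lemma wiener_integral_mean_zero:
  assumes W: "brownian_sheet M W" and X: "has_wiener_integral M W S \<psi> X"
  shows "has_bochner_integral M X 0"
proof -
  interpret prob_space M using W by (simp add: brownian_sheet_def)
  have [measurable]: "X \<in> borel_measurable M"
    using X by (simp add: has_wiener_integral_def)
  from X obtain s :: "nat \<Rightarrow> step" where
    lim: "(\<lambda>n. \<integral>\<^sup>+w. ennreal ((cmod (X w - step_integral W (s n) w))\<^sup>2) \<partial>M) \<longlonglongrightarrow> 0"
    unfolding has_wiener_integral_def by blast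
  have step: "has_bochner_integral M (step_integral W (s n)) 0" for n
    by (rule step_integral_mean_zero[OF W])
  have *: "integrable M X \<and> norm (\<integral>w. X w \<partial>M) \<le> 2 * e" if "e > 0" for e
  proof -
    have "\<forall>\<^sub>F n in sequentially.
        (\<integral>\<^sup>+w. ennreal ((cmod (X w - step_integral W (s n) w))\<^sup>2) \<partial>M) < ennreal (e\<^sup>2)"
      using lim that by (intro order_tendstoD(2)) auto
    from eventually_happens'[OF sequentially_bot this] obtain n where
      n: "(\<integral>\<^sup>+w. ennreal ((cmod (X w - step_integral W (s n) w))\<^sup>2) \<partial>M) \<le> ennreal (e\<^sup>2)"
      by (blast intro: less_imp_le)
    have [measurable]: "step_integral W (s n) \<in> borel_measurable M"
      using step by (metis borel_measurable_has_bochner_integral)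
    have Z: "integrable M (\<lambda>w. X w - step_integral W (s n) w)"
      "norm (\<integral>w. X w - step_integral W (s n) w \<partial>M) \<le> 2 * e"
      using integral_norm_le_of_L2[OF _ that n] by auto
    have st: "integrable M (step_integral W (s n))" "(\<integral>w. step_integral W (s n) w \<partial>M) = 0"
      using step[of n] by (auto simp: has_bochner_integral_iff)
    have X: "integrable M X"
      using Bochner_Integration.integrable_add[OF Z(1) st(1)] by simp
    with Z(2) st show ?thesis by simp
  qed
  have "norm (\<integral>w. X w \<partial>M) \<le> 0"
  proof (rule field_le_epsilon)
    fix e :: real assume "e > 0"
    then show "norm (\<integral>w. X w \<partial>M) \<le> 0 + e" using *[of "e / 2"] by simp
  qed
  then show ?thesis
    using *[of 1] by (simp add: has_bochner_integral_iff)
qed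

section \<open>Cosine moments\<close>

lemma integrable_mult_bounded:
  fixes h \<phi> :: "'a \<Rightarrow> 'b::{banach, second_countable_topology, real_normed_field}"
  assumes "integrable M h" and [measurable]: "\<phi> \<in> borel_measurable M"
    and "\<And>x. norm (\<phi> x) \<le> B"
  shows "integrable M (\<lambda>x. h x * \<phi> x)"
proof (rule Bochner_Integration.integrable_bound)
  show "integrable M (\<lambda>x. of_real B * h x)" using assms(1) by simp
  show "(\<lambda>x. h x * \<phi> x) \<in> borel_measurable M"
    using assms(1) by (intro borel_measurable_times) auto
  have "B \<ge> 0" using order_trans[OF norm_ge_zero assms(3)] .
  then show "AE x in M. norm (h x * \<phi> x) \<le> norm (of_real B * h x)"
    by (auto simp: norm_mult mult.commute[of B] intro!: mult_left_mono assms(3))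
qed

text \<open>Integer frequencies keep \<open>m - 1\<close> meaningful at \<open>m = 0\<close>, where
  the recursion for cosine powers crosses to negative frequencies.\<close>

lemma cos_times_cos_of_int:
  "cos t * cos (of_int m * t) = (cos (of_int (m + 1) * t) + cos (of_int (m - 1) * t :: real)) / 2"
proof -
  have "of_int (m + 1) * t = of_int m * t + t" "of_int (m - 1) * t = of_int m * t - t"
    by (simp_all add: algebra_simps)
  then show ?thesis
    by (simp only: cos_add cos_diff) simp
qed

lemma integral_cos_multiple:
  fixes c :: real
  assumes "c \<noteq> 0"
  shows "integral {-pi..pi} (\<lambda>t. cos (c * t)) = 2 * sin (c * pi) / c"
proof -
  have "((\<lambda>t. cos (c * t)) has_integral sin (c * pi) / c - sin (c * (- pi)) / c) {-pi..pi}"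
    using assms
    by (intro fundamental_theorem_of_calculus)
      (auto intro!: derivative_eq_intros simp flip: has_real_derivative_iff_has_vector_derivative)
  then show ?thesis
    by (simp add: integral_unique)
qed

text \<open>The moments say that the signed measure with density \<open>h\<close>, pushed forward
  along \<open>cos \<circ> \<theta>\<close>, is a multiple of the arcsine law, the law of
  \<open>cos t\<close> for \<open>t\<close> uniform on \<open>{-pi..pi}\<close>. The identities
  below test this on polynomials first and then on continuous functions.\<close>

locale vanishing_cosine_moments =
  fixes M :: "'a measure" and h \<theta> :: "'a \<Rightarrow> real"
  assumes h: "integrable M h" and theta [measurable]: "\<theta> \<in> borel_measurable M"
    and moments: "\<And>m::nat. m > 0 \<Longrightarrow> (\<integral>x. h x * cos (real m * \<theta> x) \<partial>M) = 0"
begin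

text \<open>The extra factor \<open>cos (m t)\<close> strengthens the claim enough for induction on
  the power: product-to-sum trades one factor \<open>cos t\<close> for a shift of \<open>m\<close>
  by one in each direction. Only \<open>m = 0\<close> is wanted in the end.\<close>

lemma cos_power_cos_moment:
  "(\<integral>x. h x * (cos (\<theta> x) ^ n * cos (of_int m * \<theta> x)) \<partial>M) =
    (\<integral>x. h x \<partial>M) / (2 * pi) * integral {-pi..pi} (\<lambda>t. cos t ^ n * cos (of_int m * t))"
proof (induction n arbitrary: m)
  case 0
  \<comment> \<open>For \<open>m \<noteq> 0\<close> both sides vanish, the left by the moment
    hypothesis and the right because \<open>sin (k * pi) = 0\<close>; negative \<open>m\<close>
    reduces to positive by evenness of the cosine.\<close>
  consider "m = 0" | k where "k > 0" "m = int k" | k where "k > 0" "m = - int k"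
    by (metis int_cases2 neg_0_equal_iff_equal of_nat_0 gr0I)
  then show ?case
  proof cases
    case 1 then show ?thesis by simp
  next
    case 2
    then show ?thesis
      using moments[of k] integral_cos_multiple[of "real k"] by simp
  next
    case 3
    then show ?thesis
      using moments[of k] integral_cos_multiple[of "real k"] by simp
  qed
next
  case (Suc n)
  let ?f = "\<lambda>m t. cos t ^ n * cos (of_int m * t) :: real"
  have split: "cos t ^ Suc n * cos (of_int m * t) = (?f (m + 1) t + ?f (m - 1) t) / 2" for t :: real
  proof -
    have "cos t ^ Suc n * cos (of_int m * t) = cos t ^ n * (cos t * cos (of_int m * t))"
      by simp
    then show ?thesis
      by (simp only: cos_times_cos_of_int distrib_left times_divide_eq_right)
  qed
  have int: "integrable M (\<lambda>x. h x * ?f j (\<theta> x))" for j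
    by (intro integrable_mult_bounded[where B = 1] h)
      (auto simp: abs_mult power_abs intro!: mult_le_one power_le_one)
  have int': "?f j integrable_on {-pi..pi}" for j
    by (intro integrable_continuous_interval continuous_intros)
  have "(\<integral>x. h x * (cos (\<theta> x) ^ Suc n * cos (of_int m * \<theta> x)) \<partial>M) =
      ((\<integral>x. h x * ?f (m + 1) (\<theta> x) \<partial>M) + (\<integral>x. h x * ?f (m - 1) (\<theta> x) \<partial>M)) / 2"
    unfolding split
    by (subst Bochner_Integration.integral_add[OF int int, symmetric])
      (simp add: distrib_left flip: integral_divide_zero)
  also have "\<dots> = (\<integral>x. h x \<partial>M) / (2 * pi) *
      ((integral {-pi..pi} (?f (m + 1)) + integral {-pi..pi} (?f (m - 1))) / 2)"
    unfolding Suc.IH by (simp add: algebra_simps)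
  also have "(integral {-pi..pi} (?f (m + 1)) + integral {-pi..pi} (?f (m - 1))) / 2 =
      integral {-pi..pi} (\<lambda>t. cos t ^ Suc n * cos (of_int m * t))"
    unfolding split by (subst Henstock_Kurzweil_Integration.integral_add[OF int' int', symmetric]) simp
  finally show ?case .
qed

lemma polynomial_cos_moment:
  assumes "real_polynomial_function P"
  shows "(\<integral>x. h x * P (cos (\<theta> x)) \<partial>M) =
    (\<integral>x. h x \<partial>M) / (2 * pi) * integral {-pi..pi} (\<lambda>t. P (cos t))"
proof -
  obtain c n where P: "P = (\<lambda>x. \<Sum>i\<le>n. c i * x ^ i)"
    using assms by (auto simp: real_polynomial_function_iff_sum)
  have int: "integrable M (\<lambda>x. h x * cos (\<theta> x) ^ i)" for i
    by (intro integrable_mult_bounded[where B = 1] h) (auto simp: power_abs intro!: power_le_one)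
  have int': "(\<lambda>t. cos t ^ i :: real) integrable_on {-pi..pi}" for i
    by (intro integrable_continuous_interval continuous_intros)
  have "(\<integral>x. h x * P (cos (\<theta> x)) \<partial>M) = (\<Sum>i\<le>n. c i * (\<integral>x. h x * cos (\<theta> x) ^ i \<partial>M))"
    using int by (simp add: P sum_distrib_left mult.left_commute)
  also have "\<dots> = (\<integral>x. h x \<partial>M) / (2 * pi) * (\<Sum>i\<le>n. c i * integral {-pi..pi} (\<lambda>t. cos t ^ i))"
    using cos_power_cos_moment[of _ 0] by (simp add: sum_distrib_left mult.left_commute)
  also have "(\<Sum>i\<le>n. c i * integral {-pi..pi} (\<lambda>t. cos t ^ i)) = integral {-pi..pi} (\<lambda>t. P (cos t))"
    unfolding P using int' by (subst integral_sum) (auto intro!: integrable_on_mult_right)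
  finally show ?thesis .
qed

text \<open>Both sides are linear in \<open>f\<close> and bounded by \<open>N\<close> times the sup
  norm on \<open>{-1..1}\<close>; they agree on polynomials, which are dense.\<close>

lemma continuous_cos_moment:
  assumes f: "continuous_on {-1..1} f"
  shows "(\<integral>x. h x * f (cos (\<theta> x)) \<partial>M) =
    (\<integral>x. h x \<partial>M) / (2 * pi) * integral {-pi..pi} (\<lambda>t. f (cos t))" (is "?A f = ?B f")
proof -
  define N where "N = (\<integral>x. \<bar>h x\<bar> \<partial>M)"
  have N: "0 \<le> N" "\<bar>\<integral>x. h x \<partial>M\<bar> \<le> N" unfolding N_def by auto
  \<comment> \<open>\<open>F\<close> is controlled only on \<open>{-1..1}\<close>, but that contains
    the range of the cosine, so \<open>F \<circ> cos\<close> is continuous on the whole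
    line.\<close>
  have fcos [measurable]: "(\<lambda>x. F (cos (\<theta> x))) \<in> borel_measurable M" if "continuous_on {-1..1} F" for F :: "real \<Rightarrow> real"
  proof -
    have "(\<lambda>t. F (cos t)) \<in> borel_measurable borel"
      using that by (intro borel_measurable_continuous_onI continuous_on_compose2[OF that] continuous_intros) auto
    from measurable_compose[OF theta this] show ?thesis .
  qed
  have int: "integrable M (\<lambda>x. h x * F (cos (\<theta> x)))" if F: "continuous_on {-1..1} F" for F :: "real \<Rightarrow> real"
  proof -
    have "compact (F ` {-1..1})" by (intro compact_continuous_image F) simp
    then obtain B where "\<And>y. y \<in> {-1..1} \<Longrightarrow> norm (F y) \<le> B"
      by (meson bounded_iff compact_imp_bounded imageI)
    then show ?thesis by (intro integrable_mult_bounded[where B = B] h fcos F) auto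
  qed
  have int': "(\<lambda>t. F (cos t)) integrable_on {-pi..pi}" if "continuous_on {-1..1} F" for F :: "real \<Rightarrow> real"
    by (intro integrable_continuous_interval continuous_on_compose2[OF that] continuous_intros) auto
  have "\<bar>?A f - ?B f\<bar> \<le> 0"
  proof (rule field_le_epsilon)
    fix e :: real assume "e > 0"
    \<comment> \<open>Each side changes by at most \<open>N * d\<close> when \<open>f\<close> is
      replaced by \<open>P\<close>, so the two errors must fit into \<open>e\<close>; the summand 1
      avoids division by zero when \<open>N = 0\<close>.\<close>
    define d where "d = e / (2 * (N + 1))"
    have d: "d > 0" "2 * (N * d) \<le> e" using \<open>e > 0\<close> N by (auto simp: d_def field_simps)
    obtain P where P: "real_polynomial_function P" "\<And>x. x \<in> {-1..1} \<Longrightarrow> \<bar>f x - P x\<bar> < d"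
      using Stone_Weierstrass_real_polynomial_function[OF _ f d(1)] by auto
    have cP: "continuous_on {-1..1} P"
      using P(1) continuous_on_polymonial_function real_polynomial_function_eq by blast
    have close: "\<bar>f (cos t) - P (cos t)\<bar> \<le> d" for t
      using P(2)[of "cos t"] by simp
    have "?A f - ?A P = (\<integral>x. h x * (f (cos (\<theta> x)) - P (cos (\<theta> x))) \<partial>M)"
      using int[OF f] int[OF cP] by (simp add: right_diff_distrib)
    also have "\<bar>\<dots>\<bar> \<le> (\<integral>x. \<bar>h x\<bar> * d \<partial>M)"
    proof (rule order_trans[OF integral_abs_bound], rule integral_mono)
      show "integrable M (\<lambda>x. \<bar>h x * (f (cos (\<theta> x)) - P (cos (\<theta> x)))\<bar>)"
        using int[OF continuous_on_diff[OF f cP]] by simp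
      show "integrable M (\<lambda>x. \<bar>h x\<bar> * d)" using h by simp
      show "\<bar>h x * (f (cos (\<theta> x)) - P (cos (\<theta> x)))\<bar> \<le> \<bar>h x\<bar> * d" for x
        unfolding abs_mult by (intro mult_left_mono close) simp
    qed
    finally have A: "\<bar>?A f - ?A P\<bar> \<le> N * d" by (simp add: N_def)
    have "?B f - ?B P = (\<integral>x. h x \<partial>M) / (2 * pi) * integral {-pi..pi} (\<lambda>t. f (cos t) - P (cos t))"
      using int'[OF f] int'[OF cP]
      by (simp add: right_diff_distrib Henstock_Kurzweil_Integration.integral_diff)
    \<comment> \<open>The interval length \<open>2 * pi\<close> cancels the normalisation, leaving
      the same error \<open>N * d\<close>.\<close>
    also have "\<bar>\<dots>\<bar> \<le> N / (2 * pi) * (d * (2 * pi))"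
    proof -
      have "norm (integral {-pi..pi} (\<lambda>t. f (cos t) - P (cos t))) \<le> d * (pi - (- pi))"
        using close
        by (intro integral_bound continuous_on_diff continuous_on_compose2[OF f]
            continuous_on_compose2[OF cP] continuous_intros) auto
      then show ?thesis
        unfolding abs_mult using N d
        by (intro mult_mono) (auto simp: divide_right_mono)
    qed
    finally have B: "\<bar>?B f - ?B P\<bar> \<le> N * d" by simp
    show "\<bar>?A f - ?B f\<bar> \<le> 0 + e"
      using A B d(2) polynomial_cos_moment[OF P(1)] by linarith
  qed
  then show ?thesis by simp
qed

lemma integral_eq_0:
  assumes "0 < c" "c < 1"
    and theta_le: "\<And>x. h x \<noteq> 0 \<Longrightarrow> \<bar>\<theta> x\<bar> \<le> pi"
    and zero: "(\<integral>x. h x * cos (c * \<theta> x) \<partial>M) = 0"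
  shows "(\<integral>x. h x \<partial>M) = 0"
proof -
  let ?f = "\<lambda>y. cos (c * arccos y)"
  \<comment> \<open>On this range \<open>arccos (cos t) = \<bar>t\<bar>\<close>, and the cosine is
    even.\<close>
  have f: "?f (cos t) = cos (c * t)" if "\<bar>t\<bar> \<le> pi" for t
  proof (cases "t \<ge> 0")
    case False
    then have "arccos (cos t) = - t" using that arccos_cos2[of t] by simp
    then show ?thesis by simp
  qed (use that in \<open>simp add: arccos_cos\<close>)
  \<comment> \<open>Where \<open>h\<close> vanishes both integrands are zero; elsewhere
    \<open>\<theta>\<close> lies in the range on which the substitution is valid.\<close>
  have "(\<integral>x. h x * cos (c * \<theta> x) \<partial>M) = (\<integral>x. h x * ?f (cos (\<theta> x)) \<partial>M)"
    using theta_le f by (intro Bochner_Integration.integral_cong) force+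
  also have "\<dots> = (\<integral>x. h x \<partial>M) / (2 * pi) * integral {-pi..pi} (\<lambda>t. ?f (cos t))"
    by (intro continuous_cos_moment continuous_intros) auto
  also have "integral {-pi..pi} (\<lambda>t. ?f (cos t)) = integral {-pi..pi} (\<lambda>t. cos (c * t))"
    by (intro Henstock_Kurzweil_Integration.integral_cong f) auto
  also have "\<dots> = 2 * sin (c * pi) / c"
    using assms(1) by (simp add: integral_cos_multiple)
  \<comment> \<open>Since \<open>0 < c * pi < pi\<close>, the sine is positive and the factor of the
    integral of \<open>h\<close> can be cancelled. At \<open>c = 1\<close> this factor would be
    zero.\<close>
  finally show ?thesis
    using zero assms(1,2) sin_gt_zero[of "c * pi"] by simp
qed

end

section \<open>Far fields as Fourier integrals\<close>

text \<open>Common form of mean far fields and Fourier coefficients. The frequency ranges over the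
  whole plane because the datum for \<open>l = (0, 0)\<close> belongs to a point off the lattice
  when \<open>0 < lam < 1\<close>.\<close>

definition fourier_integral :: "real \<Rightarrow> (real \<times> real \<Rightarrow> real) \<Rightarrow> real \<times> real \<Rightarrow> complex" where
  "fourier_integral a g p =
     (LINT x:square a|lebesgue. exp (- \<i> * of_real (p \<bullet> x)) * of_real (g x))"

lemma fourier_coeff_eq:
  "fourier_coeff a g l = 1 / of_real (a\<^sup>2) * fourier_integral a g ((2 * pi / a) *\<^sub>R lattice_vec l)"
proof -
  have "complex_of_real (g x) * cnj (fourier_basis a l x) =
      exp (- \<i> * of_real (((2 * pi / a) *\<^sub>R lattice_vec l) \<bullet> x)) * of_real (g x)" for x
    by (simp add: fourier_basis_def exp_cnj)
  then show ?thesis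
    by (simp only: fourier_coeff_def fourier_integral_def)
qed

lemma mean_far_field:
  assumes W: "brownian_sheet M W" and u: "is_far_field M W a g \<sigma> u"
    and "xhat \<in> sphere 0 1" "k > 0"
  shows "prob_space.expectation M (u xhat k) =
    exp (\<i> * of_real (pi / 4)) / of_real (sqrt (8 * pi * k)) * fourier_integral a g (k *\<^sub>R xhat)"
proof -
  interpret prob_space M using W by (simp add: brownian_sheet_def)
  obtain I where
    "has_wiener_integral M W (square a) (\<lambda>y. far_field_kernel k xhat y * of_real (\<sigma> y)) I"
    and eq: "\<And>w. w \<in> space M \<Longrightarrow>
      u xhat k w = (LINT y:square a|lebesgue. far_field_kernel k xhat y * of_real (g y)) + I w"
    using assms unfolding is_far_field_def by blast
  then have "has_bochner_integral M I 0"
    using wiener_integral_mean_zero[OF W] by blast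
  then have "expectation (u xhat k) =
      (LINT y:square a|lebesgue. far_field_kernel k xhat y * of_real (g y))"
    \<comment> \<open>\<open>u\<close> is prescribed on \<open>space M\<close> only, hence the
      congruence rule; the deterministic term is its own mean because the total mass is 1.\<close>
    using eq
    by (subst Bochner_Integration.integral_cong[OF refl eq])
      (auto simp: has_bochner_integral_iff prob_space)
  also have "\<dots> = (LINT y:square a|lebesgue. exp (\<i> * of_real (pi / 4)) / of_real (sqrt (8 * pi * k)) *
      (exp (- \<i> * of_real ((k *\<^sub>R xhat) \<bullet> y)) * of_real (g y)))"
    by (simp add: far_field_kernel_def mult.assoc)
  finally show ?thesis
    unfolding fourier_integral_def by (simp only: set_integral_mult_right)
qed

lemma direction_in_sphere: "direction l \<in> sphere 0 1"
proof -
  have "lattice_vec l \<noteq> 0" if "l \<noteq> (0, 0)"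
    using that by (cases l) (auto simp: lattice_vec_def zero_prod_def)
  then show ?thesis
    by (auto simp: direction_def dist_norm norm_Pair)
qed

section \<open>Integrability over the square and real parts of Fourier integrals\<close>

lemma square_eq_box: "square a = box (- a / 2, - a / 2) (a / 2, a / 2)"
  by (auto simp: square_def mem_box Basis_prod_def)

text \<open>The square has finite measure, and \<open>\<bar>y\<bar> \<le> 1 + y\<^sup>2\<close>,
  which follows from \<open>(\<bar>y\<bar> - 1)\<^sup>2 \<ge> 0\<close>.\<close>

lemma L2_on_square_imp_set_integrable:
  fixes g :: "real \<times> real \<Rightarrow> real"
  assumes "L2_on (square a) g"
  shows "set_integrable lebesgue (square a) g"
proof (rule set_integrable_bound)
  have "integrable lebesgue (indicat_real (square a))"
    using emeasure_lborel_box_finite[of "(- a / 2, - a / 2)" "(a / 2, a / 2)"]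
    by (simp add: square_eq_box integrable_indicator_iff)
  then have "set_integrable lebesgue (square a) (\<lambda>_. 1::real)"
    by (simp add: set_integrable_def)
  then show "set_integrable lebesgue (square a) (\<lambda>x. 1 + (norm (g x))\<^sup>2)"
    using assms by (intro set_integral_add) (auto simp: L2_on_def)
  show "set_borel_measurable lebesgue (square a) g"
    using assms by (simp add: L2_on_def)
  have "norm y \<le> norm (1 + (norm y)\<^sup>2)" for y :: real
    using sum_power2_ge_zero[of "\<bar>y\<bar> - 1" "0::real"] zero_le_power2[of y]
    by (simp add: power2_diff)
  then show "AE x in lebesgue. x \<in> square a \<longrightarrow> norm (g x) \<le> norm (1 + (norm (g x))\<^sup>2)"
    by simp
qed

text \<open>As \<open>g\<close> is real, real parts turn the complex data into the cosine moments on
  which the Weierstrass argument works.\<close>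

lemma Re_fourier_integral:
  assumes "set_integrable lebesgue (square a) g"
  shows "Re (fourier_integral a g p) =
      (\<integral>x. (indicator (square a) x * g x) * cos (p \<bullet> x) \<partial>lebesgue)"
    "integrable lebesgue (\<lambda>x. (indicator (square a) x * g x) * cos (p \<bullet> x))"
proof -
  have int: "integrable lebesgue (\<lambda>x. indicator (square a) x * g x)"
    using assms by (simp add: set_integrable_def)
  have [measurable]: "(\<lambda>x. F x) \<in> borel_measurable lebesgue" if "continuous_on UNIV F"
    for F :: "real \<times> real \<Rightarrow> 'c::real_normed_vector"
    using borel_measurable_continuous_onI[OF that] by (simp add: measurable_completion)
  show "integrable lebesgue (\<lambda>x. (indicator (square a) x * g x) * cos (p \<bullet> x))"
    by (intro integrable_mult_bounded[where B = 1] int) (auto intro!: continuous_intros)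
  have "integrable lebesgue (\<lambda>x. complex_of_real (indicator (square a) x * g x) *
      exp (- \<i> * of_real (p \<bullet> x)))"
    using int
    by (intro integrable_mult_bounded[where B = 1])
      (auto intro!: continuous_intros simp del: of_real_mult)
  moreover have "indicator (square a) x *\<^sub>R (exp (- \<i> * of_real (p \<bullet> x)) * of_real (g x)) =
      complex_of_real (indicator (square a) x * g x) * exp (- \<i> * of_real (p \<bullet> x))" for x
    by (simp add: scaleR_conv_of_real)
  ultimately show "Re (fourier_integral a g p) =
      (\<integral>x. (indicator (square a) x * g x) * cos (p \<bullet> x) \<partial>lebesgue)"
    unfolding fourier_integral_def set_lebesgue_integral_def
    by (simp add: Re_exp del: of_real_mult flip: integral_Re)
qed

lemma fourier_integral_zero:
  "fourier_integral a g 0 = of_real (\<integral>x. indicator (square a) x * g x \<partial>lebesgue)"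
  unfolding fourier_integral_def set_lebesgue_integral_def
  by (simp add: scaleR_conv_of_real flip: of_real_mult)

text \<open>Frequencies on the first axis suffice: they see only the first coordinate, scaled so
  that the square is mapped into \<open>{-pi..pi}\<close>.\<close>

lemma fourier_integral_zero_determined:
  assumes "a > 0" "0 < lam" "lam < 1"
    and g: "set_integrable lebesgue (square a) g" "set_integrable lebesgue (square a) g'"
    and lattice: "\<And>m::nat. m > 0 \<Longrightarrow> fourier_integral a g (2 * pi / a * real m, 0) =
      fourier_integral a g' (2 * pi / a * real m, 0)"
    and lam: "fourier_integral a g (2 * pi / a * lam, 0) = fourier_integral a g' (2 * pi / a * lam, 0)"
  shows "fourier_integral a g 0 = fourier_integral a g' 0"
proof -
  define h where "h x = indicator (square a) x * g x - indicator (square a) x * g' x" for x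
  define \<theta> where "\<theta> x = 2 * pi / a * fst x" for x :: "real \<times> real"
  \<comment> \<open>Real \<open>c\<close> serves both uses: \<open>c = m\<close> for the lattice
    data and \<open>c = lam\<close> for the extra datum.\<close>
  have cos_moment: "(\<integral>x. h x * cos (c * \<theta> x) \<partial>lebesgue) =
      Re (fourier_integral a g (2 * pi / a * c, 0)) - Re (fourier_integral a g' (2 * pi / a * c, 0))" for c
  proof -
    let ?p = "(2 * pi / a * c, 0) :: real \<times> real"
    have "h x * cos (c * \<theta> x) = (indicator (square a) x * g x) * cos (?p \<bullet> x)
        - (indicator (square a) x * g' x) * cos (?p \<bullet> x)" for x
      by (simp add: h_def \<theta>_def inner_prod_def algebra_simps)
    then show ?thesis
      by (simp only: Re_fourier_integral[OF g(1)] Re_fourier_integral[OF g(2)]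
          Bochner_Integration.integral_diff)
  qed
  have int: "integrable lebesgue (\<lambda>x. indicator (square a) x * g x)"
    "integrable lebesgue (\<lambda>x. indicator (square a) x * g' x)"
    using g by (auto simp: set_integrable_def)
  interpret vanishing_cosine_moments lebesgue h \<theta>
  proof
    show "integrable lebesgue h"
      using int by (simp add: h_def[abs_def])
    have "\<theta> \<in> borel_measurable borel"
      unfolding \<theta>_def[abs_def] by (intro borel_measurable_continuous_onI continuous_intros)
    then show "\<theta> \<in> borel_measurable lebesgue" by (simp add: measurable_completion)
    show "(\<integral>x. h x * cos (real m * \<theta> x) \<partial>lebesgue) = 0" if "m > 0" for m :: nat
      using lattice[OF that] by (simp add: cos_moment)
  qed
  have "(\<integral>x. h x \<partial>lebesgue) = 0"
  proof (rule integral_eq_0[OF assms(2,3)])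
    fix x assume "h x \<noteq> 0"
    then have "x \<in> square a" by (auto simp: h_def indicator_def split: if_splits)
    then have "\<bar>fst x\<bar> \<le> a / 2" by (auto simp: square_def)
    then have "2 * pi / a * \<bar>fst x\<bar> \<le> 2 * pi / a * (a / 2)"
      using assms(1) by (intro mult_left_mono) auto
    then show "\<bar>\<theta> x\<bar> \<le> pi" using assms(1) by (simp add: \<theta>_def abs_mult)
  qed (use lam in \<open>simp add: cos_moment\<close>)
  then show ?thesis
    using int by (simp add: h_def[abs_def] fourier_integral_zero)
qed

section \<open>From equal data to equal coefficients\<close>

theorem theorem1:
  fixes a :: real
  assumes "a > 0"
  shows "\<exists>lam0>0. \<forall>lam. 0 < lam \<and> lam < lam0 \<longrightarrow>
    (\<forall>(M :: 'w measure) W W' g \<sigma> g' \<sigma>' u u'.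
       brownian_sheet M W \<longrightarrow> brownian_sheet M W' \<longrightarrow>
       admissible_source a g \<sigma> \<longrightarrow> admissible_source a g' \<sigma>' \<longrightarrow>
       is_far_field M W a g \<sigma> u \<longrightarrow> is_far_field M W' a g' \<sigma>' u' \<longrightarrow>
       (\<forall>l. prob_space.expectation M (u (direction l) (wavenumber a lam l)) =
            prob_space.expectation M (u' (direction l) (wavenumber a lam l))) \<longrightarrow>
       (\<forall>l. fourier_coeff a g l = fourier_coeff a g' l))"
proof (intro exI[of _ 1] conjI allI impI)
  fix lam :: real and M :: "'w measure" and W W' g \<sigma> g' \<sigma>' u u' l
  assume lam: "0 < lam \<and> lam < 1"
    and W: "brownian_sheet M W" "brownian_sheet M W'"
    and adm: "admissible_source a g \<sigma>" "admissible_source a g' \<sigma>'"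
    and u: "is_far_field M W a g \<sigma> u" "is_far_field M W' a g' \<sigma>' u'"
    and data: "\<forall>l. prob_space.expectation M (u (direction l) (wavenumber a lam l)) =
            prob_space.expectation M (u' (direction l) (wavenumber a lam l))"
  have lattice_vec_0: "lattice_vec l = 0 \<longleftrightarrow> l = (0, 0)" for l
    by (cases l) (simp add: lattice_vec_def zero_prod_def)
  \<comment> \<open>The prefactor in the mean far field is nonzero for positive wavenumber and the
    same for both sources, so it cancels.\<close>
  have data': "fourier_integral a g (wavenumber a lam l *\<^sub>R direction l) =
      fourier_integral a g' (wavenumber a lam l *\<^sub>R direction l)" for l
  proof -
    have "wavenumber a lam l > 0"
      using lam assms by (auto simp: wavenumber_def lattice_vec_0)
    then show ?thesis
      using data[rule_format, of l] mean_far_field[OF W(1) u(1) direction_in_sphere[of l]]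
        mean_far_field[OF W(2) u(2) direction_in_sphere[of l]]
      by simp
  qed
  have lattice: "fourier_integral a g ((2 * pi / a) *\<^sub>R lattice_vec l) =
      fourier_integral a g' ((2 * pi / a) *\<^sub>R lattice_vec l)" if "l \<noteq> (0, 0)" for l
  proof -
    have "wavenumber a lam l *\<^sub>R direction l = (2 * pi / a) *\<^sub>R lattice_vec l"
      using that lattice_vec_0[of l] by (simp add: wavenumber_def direction_def)
    then show ?thesis
      using data'[of l] by simp
  qed
  have "fourier_integral a g 0 = fourier_integral a g' 0"
  proof (rule fourier_integral_zero_determined[of a lam])
    show "set_integrable lebesgue (square a) g" "set_integrable lebesgue (square a) g'"
      using adm by (auto simp: admissible_source_def intro: L2_on_square_imp_set_integrable)
    show "fourier_integral a g (2 * pi / a * real m, 0) = fourier_integral a g' (2 * pi / a * real m, 0)"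
      if "m > 0" for m
      \<comment> \<open>The positive first axis is reached by the indices
        \<open>(int m, 0)\<close>.\<close>
      using lattice[of "(int m, 0)"] that by (simp add: lattice_vec_def)
    show "fourier_integral a g (2 * pi / a * lam, 0) = fourier_integral a g' (2 * pi / a * lam, 0)"
      using data'[of "(0, 0)"] by (simp add: wavenumber_def direction_def)
  qed (use lam assms in auto)
  then show "fourier_coeff a g l = fourier_coeff a g' l"
    using lattice[of l] by (cases "l = (0, 0)") (auto simp: fourier_coeff_eq lattice_vec_0[THEN iffD2])
qed simp

end
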